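(* Let $N,P\ge 1$ be integers. For all families of non-negative coefficient variances $\vec{c}=(c_{i_1,\dots,i_p})$ and $\vec{c'}=(c'_{i_1,\dots,i_p})$, indexed by $1\le p\le P$ and $(i_1,\dots,i_p)\in\{1,\dots,N\}^p$, $$F_N(\vec{c}+\vec{c'})\le F_N(\vec{c})+F_N(\vec{c'}).$$ In particular, for all $\beta_1,\beta_2\ge 0$, $$F_{N,\sqrt{\beta_1^2+\beta_2^2}}(\vec{c})\le F_{N,\beta_1}(\vec{c})+F_{N,\beta_2}(\vec{c}).$$
   Context: Let $\Sigma_N=\{-1,1\}^N$ and let $\mu$ be the uniform probability measure on $\Sigma_N$. Given $\vec{c}$ with entries $c_{i_1,\dots,i_p}\ge 0$, let $J_{i_1,\dots,i_p}\sim\mathcal{N}(0,c_{i_1,\dots,i_p})$ be jointly independent centered Gaussians with variances $c_{i_1,\dots,i_p}$ (for $1\le p\le P$, $(i_1,\dots,i_p)\in\{1,\dots,N\}^p$), and define the random Hamiltonian on $\Sigma_N$ $$H_N(\sigma)=\sum_{p=1}^P\frac{1}{N^{(p-1)/2}}\sum_{1\le i_1,\dots,i_p\le N}J_{i_1,\dots,i_p}\,\sigma_{i_1}\cdots\sigma_{i_p}.$$ For $\beta\ge 0$ the free energy is $F_{N,\beta}(\vec{c})=\mathbb{E}\log\int_{\Sigma_N} e^{\beta H_N(\sigma)}\,\mu(d\sigma)$, and $F_N(\vec{c})=F_{N,1}(\vec{c})$. The sum $\vec{c}+\vec{c'}$ is entrywise. *)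

theory Defs
  imports "HOL-Probability.Probability"
begin

definition Sigma_N :: "nat \<Rightarrow> (nat \<Rightarrow> real) set" where
  "Sigma_N N = {1..N} \<rightarrow>\<^sub>E {-1, 1}"

(* Multi-indices (i_1, ..., i_p) are lists; different p give lists of different
   length, so the coefficients of all degrees form one family over lists. *)

definition tuples :: "nat \<Rightarrow> nat \<Rightarrow> nat list set" where
  "tuples N p = {is. length is = p \<and> set is \<subseteq> {1..N}}"

definition multi_indices :: "nat \<Rightarrow> nat \<Rightarrow> nat list set" where
  "multi_indices N P = (\<Union>p\<in>{1..P}. tuples N p)"

definition hamiltonian ::
    "nat \<Rightarrow> nat \<Rightarrow> (nat list \<Rightarrow> real) \<Rightarrow> (nat \<Rightarrow> real) \<Rightarrow> real" where
  "hamiltonian N P J \<sigma> =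
     (\<Sum>p=1..P. 1 / (real N powr ((real p - 1) / 2)) *
        (\<Sum>is\<in>tuples N p. J is * (\<Prod>k<p. \<sigma> (is ! k))))"

(* The library's normal_density takes the standard deviation and has no degenerate
   case; variance 0 gives the point mass at m.  Negative v is never used. *)

definition gaussian :: "real \<Rightarrow> real \<Rightarrow> real measure" where
  "gaussian m v = (if v > 0 then density lborel (normal_density m (sqrt v)) else return borel m)"

definition coupling_law :: "nat \<Rightarrow> nat \<Rightarrow> (nat list \<Rightarrow> real) \<Rightarrow> (nat list \<Rightarrow> real) measure" where
  "coupling_law N P c = (\<Pi>\<^sub>M is\<in>multi_indices N P. gaussian 0 (c is))"

definition log_partition :: "nat \<Rightarrow> nat \<Rightarrow> real \<Rightarrow> (nat list \<Rightarrow> real) \<Rightarrow> real" where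
  "log_partition N P \<beta> J =
     ln (\<integral>\<sigma>. exp (\<beta> * hamiltonian N P J \<sigma>) \<partial>uniform_count_measure (Sigma_N N))"

(* The couplings are realised canonically, as the coordinates of the product measure.
   The lemma free_energy_eq_expectation shows that any other realisation gives the same
   value, and integrable_log_partition that the Bochner integral is not a default value. *)

definition free_energy_at :: "nat \<Rightarrow> nat \<Rightarrow> real \<Rightarrow> (nat list \<Rightarrow> real) \<Rightarrow> real" where
  "free_energy_at N P \<beta> c = (\<integral>J. log_partition N P \<beta> J \<partial>coupling_law N P c)"

definition free_energy :: "nat \<Rightarrow> nat \<Rightarrow> (nat list \<Rightarrow> real) \<Rightarrow> real" where
  "free_energy N P c = free_energy_at N P 1 c"

lemma finite_Sigma_N: "finite (Sigma_N N)"
  unfolding Sigma_N_def by (intro finite_PiE) auto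

lemma Sigma_N_nonempty: "Sigma_N N \<noteq> {}"
  unfolding Sigma_N_def by (simp add: PiE_eq_empty_iff)

lemma finite_tuples: "finite (tuples N p)"
  using finite_lists_length_eq[of "{1..N}" p] by (simp add: tuples_def conj_commute)

lemma finite_multi_indices: "finite (multi_indices N P)"
  unfolding multi_indices_def by (simp add: finite_tuples)

lemma sets_gaussian [simp, measurable_cong]: "sets (gaussian m v) = sets borel"
  by (simp add: gaussian_def)

lemma space_gaussian [simp]: "space (gaussian m v) = UNIV"
  by (simp add: gaussian_def)

lemma prob_space_gaussian: "prob_space (gaussian m v)"
  by (auto simp: gaussian_def intro!: prob_space_normal_density prob_space_return)

lemma sets_coupling_law:
  "sets (coupling_law N P c) = sets (\<Pi>\<^sub>M is\<in>multi_indices N P. borel)"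
  unfolding coupling_law_def by (intro sets_PiM_cong) auto

lemma prob_space_coupling_law: "prob_space (coupling_law N P c)"
  unfolding coupling_law_def by (intro prob_space_PiM prob_space_gaussian)

lemma log_partition_eq_sum:
  "log_partition N P \<beta> J =
     ln ((\<Sum>\<sigma>\<in>Sigma_N N. exp (\<beta> * hamiltonian N P J \<sigma>)) / card (Sigma_N N))"
  by (simp add: log_partition_def uniform_count_measure_def lebesgue_integral_point_measure_finite
      finite_Sigma_N sum_divide_distrib)

lemma measurable_log_partition:
  "log_partition N P \<beta> \<in> borel_measurable (\<Pi>\<^sub>M is\<in>multi_indices N P. borel)"
proof -
  have "(\<lambda>J. hamiltonian N P J \<sigma>) \<in> borel_measurable (\<Pi>\<^sub>M is\<in>multi_indices N P. borel)" for \<sigma>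
    unfolding hamiltonian_def
    by (intro borel_measurable_sum borel_measurable_times measurable_const
        measurable_component_singleton) (auto simp: multi_indices_def)
  then show ?thesis
    unfolding log_partition_eq_sum[abs_def] by measurable
qed

lemma free_energy_eq_expectation:
  fixes J :: "nat list \<Rightarrow> 'a \<Rightarrow> real"
  assumes "N \<ge> 1" and "P \<ge> 1" and "prob_space M"
    and indep: "prob_space.indep_vars M (\<lambda>_. borel) J (multi_indices N P)"
    and law: "\<And>is. is \<in> multi_indices N P \<Longrightarrow> distr M borel (J is) = gaussian 0 (c is)"
  shows "free_energy_at N P \<beta> c = (\<integral>\<omega>. log_partition N P \<beta> (\<lambda>is. J is \<omega>) \<partial>M)"
proof -
  interpret prob_space M by fact
  let ?I = "multi_indices N P"
  let ?r = "\<lambda>\<omega>. \<lambda>is\<in>?I. J is \<omega>"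
  have rv: "J is \<in> borel_measurable M" if "is \<in> ?I" for "is"
    using indep that by (auto simp: indep_vars_def)
  have "[1] \<in> ?I"
    using assms by (auto simp: multi_indices_def tuples_def intro!: bexI[of _ 1])
  then have ne: "?I \<noteq> {}" by blast
  have m: "?r \<in> measurable M (\<Pi>\<^sub>M is\<in>?I. borel)"
    by (intro measurable_restrict rv)
  have eq: "coupling_law N P c = distr M (\<Pi>\<^sub>M is\<in>?I. borel) ?r"
  proof -
    have "distr M (\<Pi>\<^sub>M is\<in>?I. borel) ?r = (\<Pi>\<^sub>M is\<in>?I. distr M borel (J is))"
      using indep_vars_iff_distr_eq_PiM'[of ?I J "\<lambda>_. borel", OF ne] rv indep by simp
    also have "\<dots> = coupling_law N P c"
      unfolding coupling_law_def by (intro PiM_cong) (auto simp: law)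
    finally show ?thesis ..
  qed
  have "hamiltonian N P (?r \<omega>) \<sigma> = hamiltonian N P (\<lambda>is. J is \<omega>) \<sigma>" for \<omega> \<sigma>
    unfolding hamiltonian_def
    by (intro sum.cong refl arg_cong2[of _ _ _ _ "(*)"]) (auto simp: multi_indices_def)
  then have "log_partition N P \<beta> (?r \<omega>) = log_partition N P \<beta> (\<lambda>is. J is \<omega>)" for \<omega>
    by (simp add: log_partition_def)
  then show ?thesis
    unfolding free_energy_at_def eq by (simp add: integral_distr[OF m measurable_log_partition])
qed

lemma integrable_gaussian_abs: "integrable (gaussian 0 v) (\<lambda>x. \<bar>x\<bar>)"
proof (cases "v > 0")
  case True
  have "integrable lborel (\<lambda>x. normal_density 0 (sqrt v) x * \<bar>x - 0\<bar> ^ 1)"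
    by (rule integrable_normal_moment_abs) (use True in simp)
  then show ?thesis
    using True by (simp add: gaussian_def integrable_real_density)
next
  case False
  then show ?thesis
    by (simp add: gaussian_def integrable_iff_bounded nn_integral_return)
qed

lemma integrable_log_partition: "integrable (coupling_law N P c) (log_partition N P \<beta>)"
proof -
  let ?I = "multi_indices N P"
  let ?M = "coupling_law N P c"
  interpret product_prob_space "\<lambda>is. gaussian 0 (c is)" ?I
    by (intro product_prob_spaceI prob_space_gaussian)
  define a :: "nat \<Rightarrow> real" where "a p = 1 / (real N powr ((real p - 1) / 2))" for p
  define B where "B J = \<bar>\<beta>\<bar> * (\<Sum>p=1..P. a p * (\<Sum>is\<in>tuples N p. \<bar>J is\<bar>))" for J :: "nat list \<Rightarrow> real"
  have a0: "a p \<ge> 0" for p by (simp add: a_def)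
  have int1: "integrable ?M (\<lambda>J. \<bar>J is\<bar>)" if "is \<in> ?I" for "is"
  proof -
    have d: "distr ?M (gaussian 0 (c is)) (\<lambda>J. J is) = gaussian 0 (c is)"
      unfolding coupling_law_def by (rule PiM_component) (use that in auto)
    have m: "(\<lambda>J. J is) \<in> measurable ?M (gaussian 0 (c is))"
      unfolding coupling_law_def by (rule measurable_component_singleton[OF that])
    show ?thesis
      using integrable_distr[OF m, of "\<lambda>x. \<bar>x\<bar>"] integrable_gaussian_abs[of "c is"] d by simp
  qed
  have intB: "integrable ?M B"
    unfolding B_def
    by (intro integrable_mult_right Bochner_Integration.integrable_sum int1) (auto simp: multi_indices_def)
  have bound: "\<bar>log_partition N P \<beta> J\<bar> \<le> B J" for J
  proof -
    let ?S = "Sigma_N N"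
    have H: "\<bar>\<beta> * hamiltonian N P J \<sigma>\<bar> \<le> B J" if s: "\<sigma> \<in> ?S" for \<sigma>
    proof -
      have p1: "\<bar>\<Prod>k<p. \<sigma> (is ! k)\<bar> = 1" if "is \<in> tuples N p" for p "is"
      proof -
        have "\<bar>\<sigma> (is ! k)\<bar> = 1" if "k < p" for k
        proof -
          have "is ! k \<in> {1..N}" using \<open>is \<in> tuples N p\<close> that nth_mem[of k "is"]
            unfolding tuples_def by blast
          then show ?thesis using PiE_mem[OF s[unfolded Sigma_N_def]] by fastforce
        qed
        then show ?thesis by (simp add: abs_prod)
      qed
      have "\<bar>hamiltonian N P J \<sigma>\<bar> \<le> (\<Sum>p=1..P. a p * (\<Sum>is\<in>tuples N p. \<bar>J is\<bar>))"
        unfolding hamiltonian_def a_def[symmetric]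
      proof (rule order_trans[OF sum_abs sum_mono])
        fix p
        have "\<bar>\<Sum>is\<in>tuples N p. J is * (\<Prod>k<p. \<sigma> (is ! k))\<bar> \<le> (\<Sum>is\<in>tuples N p. \<bar>J is\<bar>)"
          by (rule order_trans[OF sum_abs sum_mono]) (simp add: abs_mult p1)
        then show "\<bar>a p * (\<Sum>is\<in>tuples N p. J is * (\<Prod>k<p. \<sigma> (is ! k)))\<bar>
            \<le> a p * (\<Sum>is\<in>tuples N p. \<bar>J is\<bar>)"
          using a0[of p] by (simp add: abs_mult mult_left_mono)
      qed
      then show ?thesis by (simp add: B_def abs_mult mult_left_mono)
    qed
    have card: "real (card ?S) > 0"
      using finite_Sigma_N Sigma_N_nonempty by (simp add: card_gt_0_iff)
    define Z where "Z = (\<Sum>\<sigma>\<in>?S. exp (\<beta> * hamiltonian N P J \<sigma>)) / card ?S"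
    have "(\<Sum>\<sigma>\<in>?S. exp (\<beta> * hamiltonian N P J \<sigma>)) \<le> real (card ?S) * exp (B J)"
      by (rule sum_bounded_above) (use H in force)
    then have up: "Z \<le> exp (B J)"
      using card by (simp add: Z_def field_simps)
    have "real (card ?S) * exp (- B J) \<le> (\<Sum>\<sigma>\<in>?S. exp (\<beta> * hamiltonian N P J \<sigma>))"
      by (rule sum_bounded_below) (use H in force)
    then have lo: "exp (- B J) \<le> Z"
      using card by (simp add: Z_def field_simps)
    have Zpos: "Z > 0" using lo exp_gt_zero less_le_trans by blast
    have "ln Z \<le> B J" using up Zpos by (metis ln_exp ln_mono exp_gt_zero)
    moreover have "- B J \<le> ln Z" using lo Zpos by (metis ln_exp ln_mono exp_gt_zero)
    ultimately show ?thesis by (simp add: log_partition_eq_sum Z_def)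
  qed
  show ?thesis
  proof (rule Bochner_Integration.integrable_bound[OF intB])
    show "log_partition N P \<beta> \<in> borel_measurable ?M"
      using measurable_log_partition measurable_cong_sets[OF sets_coupling_law refl] by blast
    show "AE J in ?M. norm (log_partition N P \<beta> J) \<le> norm (B J)"
      using bound by (auto intro!: AE_I2 order_trans[OF bound abs_ge_self])
  qed
qed

end

theory Submission
  imports Defs
begin

text \<open>
  The proof rests on a gauge symmetry and on concavity of the logarithm. Write
  \<open>Z J\<close> for the average of \<open>exp (H J \<sigma>)\<close> over all spin configurations, so that the
  free energy is the expectation of \<open>ln (Z J)\<close>. Let \<open>a\<close> and \<open>b\<close> be independent couplings
  with variances \<open>c\<close> and \<open>c'\<close>; then \<open>a + b\<close> has variances \<open>c + c'\<close>. For a spin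
  configuration \<open>\<tau>\<close>, replacing each entry \<open>b is\<close> by its product with the spins of \<open>\<tau>\<close> at
  the indices in \<open>is\<close> changes \<open>H b \<sigma>\<close> into \<open>H b (\<tau> \<cdot> \<sigma>)\<close>, where the dot is the
  entrywise product. This changes only signs of \<open>b\<close>, and centred Gaussians are symmetric,
  so the law of the resulting couplings \<open>a + \<tau>b\<close> does not depend on \<open>\<tau>\<close>.

  Hence the free energy for \<open>c + c'\<close> is also the expectation of the average of
  \<open>ln (Z (a + \<tau>b))\<close> over \<open>\<tau>\<close>. By Jensen's inequality that average is, for every \<open>a\<close> and
  \<open>b\<close>, at most the logarithm of the average of \<open>Z (a + \<tau>b)\<close>. The latter average factorises:
  for fixed \<open>\<sigma>\<close> the configuration \<open>\<tau> \<cdot> \<sigma>\<close> is uniform when \<open>\<tau>\<close> is, which gives exactly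
  \<open>Z a * Z b\<close>. This pointwise bound is \<open>gauge_averaged_log_partition_le\<close>, and taking
  expectations gives \<open>free_energy_add_le\<close>.

  The statement about inverse temperatures is the special case of variances
  \<open>\<beta>\<^sub>1\<^sup>2 * c\<close> and \<open>\<beta>\<^sub>2\<^sup>2 * c\<close>, since multiplying the couplings by \<open>\<beta>\<close> multiplies their
  variances by \<open>\<beta>\<^sup>2\<close>. Adding, flipping signs, scaling and taking marginals are all
  instances of one fact about laws, \<open>distr_coupling_law_linear\<close>.
\<close>

section \<open>Laws of linear combinations of independent Gaussian families\<close>

text \<open>
  A map that combines two product-distributed families entry by entry acts on each pair of
  entries separately, so independence of the entries survives. A finite product measure is
  determined by its values on boxes, and there Tonelli's theorem factors the probability.
\<close>

lemma distr_pair_PiM_componentwise: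
  fixes f :: "'i \<Rightarrow> 'a \<Rightarrow> 'b \<Rightarrow> 'c"
  assumes I: "finite I"
    and M: "\<And>i. prob_space (M i)" and N: "\<And>i. prob_space (N i)"
    and K: "\<And>i. i \<in> I \<Longrightarrow> sets (K i) = sets (L i)"
    and f[measurable]: "\<And>i. i \<in> I \<Longrightarrow> case_prod (f i) \<in> measurable (M i \<Otimes>\<^sub>M N i) (L i)"
    and law: "\<And>i. i \<in> I \<Longrightarrow> distr (M i \<Otimes>\<^sub>M N i) (L i) (case_prod (f i)) = K i"
    and pK: "\<And>i. prob_space (K i)"
  shows "distr (PiM I M \<Otimes>\<^sub>M PiM I N) (PiM I L) (\<lambda>(x, y). \<lambda>i\<in>I. f i (x i) (y i)) = PiM I K"
proof -
  interpret M: product_prob_space M I by (intro product_prob_spaceI M)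
  interpret N: product_prob_space N I by (intro product_prob_spaceI N)
  interpret K: product_prob_space K I by (intro product_prob_spaceI pK)
  have sfPN: "sigma_finite_measure (PiM I N)"
    by (intro prob_space_imp_sigma_finite prob_space_PiM N)
  have sfN: "sigma_finite_measure (N i)" for i
    by (rule prob_space_imp_sigma_finite[OF N])
  let ?T = "\<lambda>(x, y). \<lambda>i\<in>I. f i (x i) (y i)"
  have fT: "(\<lambda>z. f i (fst z i) (snd z i)) \<in> measurable (PiM I M \<Otimes>\<^sub>M PiM I N) (L i)"
    if "i \<in> I" for i
  proof -
    have "(\<lambda>z. (fst z i, snd z i)) \<in> measurable (PiM I M \<Otimes>\<^sub>M PiM I N) (M i \<Otimes>\<^sub>M N i)"
      using that by measurable
    from measurable_compose[OF this f[OF that]] show ?thesis by simp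
  qed
  have T[measurable]: "?T \<in> measurable (PiM I M \<Otimes>\<^sub>M PiM I N) (PiM I L)"
    unfolding case_prod_beta by (intro measurable_restrict fT)
  show ?thesis
  proof (rule K.PiM_eqI[OF I])
    show "sets (distr (PiM I M \<Otimes>\<^sub>M PiM I N) (PiM I L) ?T) = sets (PiM I K)"
      using K by (simp cong: sets_PiM_cong)
    fix A assume A: "\<And>i. i \<in> I \<Longrightarrow> A i \<in> sets (K i)"
    have A'[measurable]: "A i \<in> sets (L i)" if "i \<in> I" for i
      using A K that by auto
    have ind: "(\<lambda>z. indicator (A i) (case_prod (f i) z) :: ennreal)
        \<in> borel_measurable (M i \<Otimes>\<^sub>M N i)" if "i \<in> I" for i
      using that f[OF that] by measurable
    have indx: "(\<lambda>y. indicator (A i) (f i x y) :: ennreal) \<in> borel_measurable (N i)"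
      if "i \<in> I" "x \<in> space (M i)" for i x
      using measurable_compose[OF measurable_Pair1'[OF that(2)] ind[OF that(1)]] by simp
    have indint: "(\<lambda>x. \<integral>\<^sup>+ y. indicator (A i) (f i x y) \<partial>N i) \<in> borel_measurable (M i)"
      if "i \<in> I" for i
      using sigma_finite_measure.borel_measurable_nn_integral_fst[OF sfN ind[OF that]] by simp
    have box: "PiE I A \<in> sets (PiM I L)"
      using A' I by (intro sets_PiM_I_finite) auto
    have "emeasure (distr (PiM I M \<Otimes>\<^sub>M PiM I N) (PiM I L) ?T) (PiE I A)
        = (\<integral>\<^sup>+ z. indicator (PiE I A) (?T z) \<partial>(PiM I M \<Otimes>\<^sub>M PiM I N))"
      using box nn_integral_distr[OF T, of "indicator (PiE I A)"] by simp
    also have "\<dots> = (\<integral>\<^sup>+ x. \<integral>\<^sup>+ y. indicator (PiE I A) (?T (x, y)) \<partial>PiM I N \<partial>PiM I M)"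
      by (rule sigma_finite_measure.nn_integral_fst[OF sfPN, symmetric]) (use box in measurable)
    also have "\<dots> = (\<integral>\<^sup>+ x. \<integral>\<^sup>+ y. (\<Prod>i\<in>I. indicator (A i) (f i (x i) (y i))) \<partial>PiM I N \<partial>PiM I M)"
    proof (intro nn_integral_cong)
      fix x y
      show "indicator (PiE I A) (?T (x, y)) = (\<Prod>i\<in>I. indicator (A i) (f i (x i) (y i)) :: ennreal)"
        using I by (auto simp: indicator_def PiE_iff prod_zero_iff)
    qed
    also have "\<dots> = (\<integral>\<^sup>+ x. (\<Prod>i\<in>I. \<integral>\<^sup>+ y. indicator (A i) (f i (x i) y) \<partial>N i) \<partial>PiM I M)"
      by (intro nn_integral_cong N.product_nn_integral_prod I indx)
        (auto simp: space_PiM)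
    also have "\<dots> = (\<Prod>i\<in>I. \<integral>\<^sup>+ x. \<integral>\<^sup>+ y. indicator (A i) (f i x y) \<partial>N i \<partial>M i)"
      by (intro M.product_nn_integral_prod I indint)
    also have "\<dots> = (\<Prod>i\<in>I. emeasure (K i) (A i))"
    proof (rule prod.cong[OF refl])
      fix i assume i: "i \<in> I"
      have "(\<integral>\<^sup>+ x. \<integral>\<^sup>+ y. indicator (A i) (f i x y) \<partial>N i \<partial>M i)
          = (\<integral>\<^sup>+ z. indicator (A i) (case_prod (f i) z) \<partial>(M i \<Otimes>\<^sub>M N i))"
        using sigma_finite_measure.nn_integral_fst[OF sfN ind[OF i]] by simp
      also have "\<dots> = emeasure (distr (M i \<Otimes>\<^sub>M N i) (L i) (case_prod (f i))) (A i)"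
        using A'[OF i] nn_integral_distr[OF f[OF i], of "indicator (A i)"] by simp
      finally show "(\<integral>\<^sup>+ x. \<integral>\<^sup>+ y. indicator (A i) (f i x y) \<partial>N i \<partial>M i) = emeasure (K i) (A i)"
        by (simp add: law[OF i])
    qed
    finally show "emeasure (distr (PiM I M \<Otimes>\<^sub>M PiM I N) (PiM I L) ?T) (PiE I A)
        = (\<Prod>i\<in>I. emeasure (K i) (A i))" .
  qed
qed

lemma real_distribution_gaussian: "real_distribution (gaussian m v)"
  by (simp add: real_distribution_def real_distribution_axioms_def prob_space_gaussian)

text \<open>
  Zero variance is included: scaling by 0 produces the point mass. Facts about
  \<open>gaussian\<close> derived from this representation need no case distinction.
\<close>

lemma gaussian_eq_scaled_std_normal:
  assumes "v \<ge> 0"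
  shows "gaussian 0 v = distr std_normal_distribution borel (\<lambda>x. sqrt v * x)"
proof (cases "v = 0")
  case True
  interpret prob_space std_normal_distribution
    by (rule prob_space_normal_density) simp
  show ?thesis using True by (simp add: gaussian_def distr_const)
next
  case False
  then have v: "v > 0" using assms by simp
  interpret prob_space std_normal_distribution
    by (rule prob_space_normal_density) simp
  have "distributed std_normal_distribution lborel (\<lambda>x. x) std_normal_density"
    by (simp add: distributed_def distr_id2)
  from normal_density_affine[OF this, of "sqrt v" 0]
  have "distributed std_normal_distribution lborel (\<lambda>x. sqrt v * x) (normal_density 0 (sqrt v))"
    using v by simp
  then have "distr std_normal_distribution lborel (\<lambda>x. sqrt v * x)
      = density lborel (normal_density 0 (sqrt v))"
    by (simp add: distributed_def)
  moreover have "distr std_normal_distribution lborel (\<lambda>x. sqrt v * x)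
      = distr std_normal_distribution borel (\<lambda>x. sqrt v * x)"
    by (intro distr_cong) auto
  ultimately show ?thesis using v by (simp add: gaussian_def)
qed

lemma char_gaussian:
  assumes "v \<ge> 0"
  shows "char (gaussian 0 v) t = complex_of_real (exp (- (v * t\<^sup>2) / 2))"
proof -
  have "char (gaussian 0 v) t = char std_normal_distribution (t * sqrt v)"
    unfolding gaussian_eq_scaled_std_normal[OF assms] char_def
    by (subst integral_distr) (auto simp: mult_ac)
  then show ?thesis
    using assms by (simp add: char_std_normal_distribution power_mult_distrib mult_ac)
qed

text \<open>
  The characteristic functions agree. Comparing them instead of convolving densities
  also covers point masses, that is, vanishing variances or coefficients.
\<close>

lemma distr_gaussian_pair_linear:
  assumes "u \<ge> 0" "v \<ge> 0"
  shows "distr (gaussian 0 u \<Otimes>\<^sub>M gaussian 0 v) borel (\<lambda>(x, y). r * x + s * y)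
    = gaussian 0 (r\<^sup>2 * u + s\<^sup>2 * v)"
proof -
  interpret U: real_distribution "gaussian 0 u" by (rule real_distribution_gaussian)
  interpret V: real_distribution "gaussian 0 v" by (rule real_distribution_gaussian)
  interpret P: pair_prob_space "gaussian 0 u" "gaussian 0 v" ..
  let ?D = "distr (gaussian 0 u \<Otimes>\<^sub>M gaussian 0 v) borel (\<lambda>(x, y). r * x + s * y)"
  show ?thesis
  proof (rule Levy_uniqueness)
    show "real_distribution ?D"
      by (simp add: real_distribution_def real_distribution_axioms_def P.prob_space_distr)
    show "real_distribution (gaussian 0 (r\<^sup>2 * u + s\<^sup>2 * v))"
      by (rule real_distribution_gaussian)
    show "char ?D = char (gaussian 0 (r\<^sup>2 * u + s\<^sup>2 * v))"
    proof
      fix t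
      let ?g = "\<lambda>z :: real \<times> real. iexp (t * (r * fst z + s * snd z))"
      have int: "integrable (gaussian 0 u \<Otimes>\<^sub>M gaussian 0 v) ?g"
        using P.integrable_iexp[of "\<lambda>z. t * (r * fst z + s * snd z)"] by simp
      have "char ?D t = (CLINT z|gaussian 0 u \<Otimes>\<^sub>M gaussian 0 v. ?g z)"
        unfolding char_def by (subst integral_distr) (auto simp: case_prod_beta)
      also have "\<dots> = (CLINT x|gaussian 0 u. CLINT y|gaussian 0 v. ?g (x, y))"
        by (rule P.integral_fst'[OF int, symmetric])
      also have "\<dots> = (CLINT x|gaussian 0 u. CLINT y|gaussian 0 v.
          iexp (t * r * x) * iexp (t * s * y))"
        by (simp add: exp_add[symmetric] algebra_simps)
      also have "\<dots> = char (gaussian 0 u) (t * r) * char (gaussian 0 v) (t * s)"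
        by (simp add: char_def)
      also have "\<dots> = complex_of_real
          (exp (- (u * (t * r)\<^sup>2) / 2) * exp (- (v * (t * s)\<^sup>2) / 2))"
        using assms by (simp add: char_gaussian)
      also have "\<dots> = complex_of_real (exp (- ((r\<^sup>2 * u + s\<^sup>2 * v) * t\<^sup>2) / 2))"
        by (simp add: exp_add[symmetric] field_simps)
      also have "\<dots> = char (gaussian 0 (r\<^sup>2 * u + s\<^sup>2 * v)) t"
        using assms by (simp add: char_gaussian)
      finally show "char ?D t = char (gaussian 0 (r\<^sup>2 * u + s\<^sup>2 * v)) t" .
    qed
  qed
qed

text \<open>
  The coefficients depend on the multi-index so that they can carry the gauge signs.
  Only their squares appear on the right, which is the invariance of the law under gauge
  transformations.
\<close>

lemma distr_coupling_law_linear: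
  assumes u: "\<And>is. is \<in> multi_indices N P \<Longrightarrow> u is \<ge> 0"
    and v: "\<And>is. is \<in> multi_indices N P \<Longrightarrow> v is \<ge> 0"
  shows "distr (coupling_law N P u \<Otimes>\<^sub>M coupling_law N P v) (\<Pi>\<^sub>M is\<in>multi_indices N P. borel)
      (\<lambda>(a, b). \<lambda>is\<in>multi_indices N P. r is * a is + s is * b is)
    = coupling_law N P (\<lambda>is. (r is)\<^sup>2 * u is + (s is)\<^sup>2 * v is)"
  unfolding coupling_law_def
  by (rule distr_pair_PiM_componentwise[where f="\<lambda>is x y. r is * x + s is * y"])
    (auto simp: finite_multi_indices prob_space_gaussian distr_gaussian_pair_linear u v)

text \<open>
  The form in which the identity of laws is used: integrals over a pair of independent
  couplings become free energies. The coefficient families (1, 0) and (0, 1) recover the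
  two marginals.
\<close>

lemma expectation_coupling_law_linear:
  assumes u: "\<And>is. is \<in> multi_indices N P \<Longrightarrow> u is \<ge> 0"
    and v: "\<And>is. is \<in> multi_indices N P \<Longrightarrow> v is \<ge> 0"
    and w: "\<And>is. is \<in> multi_indices N P \<Longrightarrow> w is = (r is)\<^sup>2 * u is + (s is)\<^sup>2 * v is"
  shows "integrable (coupling_law N P u \<Otimes>\<^sub>M coupling_law N P v)
      (\<lambda>z. log_partition N P \<beta> (\<lambda>is. r is * fst z is + s is * snd z is))" (is ?int)
    and "(\<integral>z. log_partition N P \<beta> (\<lambda>is. r is * fst z is + s is * snd z is)
      \<partial>(coupling_law N P u \<Otimes>\<^sub>M coupling_law N P v)) = free_energy_at N P \<beta> w" (is ?eq)
proof -
  let ?I = "multi_indices N P"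
  let ?Q = "coupling_law N P u \<Otimes>\<^sub>M coupling_law N P v"
  let ?T = "\<lambda>(a, b). \<lambda>is\<in>?I. r is * a is + s is * b is"
  have W: "coupling_law N P w = distr ?Q (\<Pi>\<^sub>M is\<in>?I. borel) ?T"
  proof -
    have "coupling_law N P w = coupling_law N P (\<lambda>is. (r is)\<^sup>2 * u is + (s is)\<^sup>2 * v is)"
      unfolding coupling_law_def by (intro PiM_cong) (auto simp: w)
    then show ?thesis
      using distr_coupling_law_linear[of N P u v r s, OF u v] by simp
  qed
  have T: "?T \<in> measurable ?Q (\<Pi>\<^sub>M is\<in>?I. borel)"
    unfolding coupling_law_def by measurable
  have restr: "log_partition N P \<beta> (\<lambda>is\<in>?I. J is) = log_partition N P \<beta> J" for J
  proof -
    have "hamiltonian N P (\<lambda>is\<in>?I. J is) \<sigma> = hamiltonian N P J \<sigma>" for \<sigma>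
      unfolding hamiltonian_def
      by (intro sum.cong refl arg_cong2[of _ _ _ _ "(*)"]) (auto simp: multi_indices_def)
    then show ?thesis by (simp add: log_partition_def)
  qed
  show ?int
    using integrable_distr[OF T, of "log_partition N P \<beta>"] integrable_log_partition[of N P w \<beta>]
    unfolding W by (simp add: case_prod_beta restr)
  show ?eq
    unfolding free_energy_at_def W integral_distr[OF T measurable_log_partition]
    by (simp add: case_prod_beta restr)
qed

section \<open>The gauge action on couplings\<close>

definition spin_product :: "(nat \<Rightarrow> real) \<Rightarrow> nat list \<Rightarrow> real" where
  "spin_product \<tau> is = (\<Prod>k<length is. \<tau> (is ! k))"

lemma spin_product_square:
  assumes "\<tau> \<in> Sigma_N N" "is \<in> multi_indices N P"
  shows "(spin_product \<tau> is)\<^sup>2 = 1"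
proof -
  have "(\<tau> (is ! k))\<^sup>2 = 1" if "k < length is" for k
  proof -
    have "is ! k \<in> {1..N}"
      using assms(2) nth_mem[OF that] by (auto simp: multi_indices_def tuples_def)
    then have "\<tau> (is ! k) \<in> {-1, 1}"
      using PiE_mem[OF assms(1)[unfolded Sigma_N_def]] by blast
    then show ?thesis by auto
  qed
  then show ?thesis by (simp add: spin_product_def prod_power_distrib)
qed

text \<open>
  The product of the \<open>\<sigma>\<close>-spins along a multi-index is multiplicative in \<open>\<sigma>\<close>, so the spins
  of \<open>\<tau>\<close> can be absorbed either by the couplings or by the configuration.
\<close>

lemma hamiltonian_gauge:
  "hamiltonian N P (\<lambda>is. spin_product \<tau> is * b is) \<sigma>
    = hamiltonian N P b (\<lambda>i\<in>{1..N}. \<tau> i * \<sigma> i)"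
  unfolding hamiltonian_def
proof (intro sum.cong refl arg_cong[of _ _ "(*) _"])
  fix p "is" assume "is \<in> tuples N p"
  then have len: "length is = p" and sub: "\<And>k. k < p \<Longrightarrow> is ! k \<in> {1..N}"
    unfolding tuples_def using nth_mem[of _ "is"] by blast+
  have "(\<Prod>k<p. (\<lambda>i\<in>{1..N}. \<tau> i * \<sigma> i) (is ! k)) = (\<Prod>k<p. \<tau> (is ! k) * \<sigma> (is ! k))"
    using sub by (intro prod.cong) auto
  then show "spin_product \<tau> is * b is * (\<Prod>k<p. \<sigma> (is ! k))
      = b is * (\<Prod>k<p. (\<lambda>i\<in>{1..N}. \<tau> i * \<sigma> i) (is ! k))"
    by (simp add: spin_product_def len prod.distrib)
qed

lemma hamiltonian_add:
  "hamiltonian N P (\<lambda>is. a is + b is) \<sigma> = hamiltonian N P a \<sigma> + hamiltonian N P b \<sigma>"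
  by (simp add: hamiltonian_def distrib_right distrib_left sum.distrib)

lemma log_partition_scale:
  "log_partition N P 1 (\<lambda>is. \<beta> * J is) = log_partition N P \<beta> J"
  by (simp add: log_partition_def hamiltonian_def sum_distrib_left mult_ac)

text \<open>
  Multiplication by a fixed configuration is an involution of the hypercube.
\<close>

lemma sum_Sigma_N_translate:
  assumes "\<sigma> \<in> Sigma_N N"
  shows "(\<Sum>\<tau>\<in>Sigma_N N. g (\<lambda>i\<in>{1..N}. \<tau> i * \<sigma> i)) = (\<Sum>\<tau>\<in>Sigma_N N. g \<tau>)"
proof -
  let ?m = "\<lambda>\<tau>. \<lambda>i\<in>{1..N}. \<tau> i * \<sigma> i"
  have sq: "\<sigma> i = -1 \<or> \<sigma> i = 1" if "i \<in> {1..N}" for i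
    using PiE_mem[OF assms[unfolded Sigma_N_def] that] by blast
  have m: "?m \<tau> \<in> Sigma_N N" if t: "\<tau> \<in> Sigma_N N" for \<tau>
    unfolding Sigma_N_def
  proof (intro PiE_I)
    fix i assume i: "i \<in> {1..N}"
    show "?m \<tau> i \<in> {-1, 1}"
      using sq[OF i] PiE_mem[OF t[unfolded Sigma_N_def] i] i by auto
  next
    fix i assume "i \<notin> {1..N}"
    then show "?m \<tau> i = undefined" by (simp only: restrict_apply if_False)
  qed
  have inv: "?m (?m \<tau>) = \<tau>" if t: "\<tau> \<in> Sigma_N N" for \<tau>
  proof
    fix i
    show "?m (?m \<tau>) i = \<tau> i"
    proof (cases "i \<in> {1..N}")
      case True
      then have "?m (?m \<tau>) i = \<tau> i * \<sigma> i * \<sigma> i" by simp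
      then show ?thesis using sq[OF True] by (elim disjE) simp_all
    next
      case False
      then have "?m (?m \<tau>) i = undefined" by (simp only: restrict_apply if_False)
      then show ?thesis using PiE_arb[OF t[unfolded Sigma_N_def] False] by simp
    qed
  qed
  show ?thesis
    by (rule sum.reindex_bij_witness[where i="?m" and j="?m"]) (rule m inv refl | assumption)+
qed

section \<open>Subadditivity\<close>

text \<open>
  Jensen's inequality over the gauge group, for fixed couplings. Averaging over \<open>\<tau>\<close> makes
  the second system uniform whatever Gibbs weights the first one puts on \<open>\<sigma>\<close>, and this
  decouples the two.
\<close>

lemma gauge_averaged_log_partition_le:
  "(\<Sum>\<tau>\<in>Sigma_N N. log_partition N P 1 (\<lambda>is. a is + spin_product \<tau> is * b is))
    \<le> real (card (Sigma_N N)) * (log_partition N P 1 a + log_partition N P 1 b)"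
proof -
  let ?S = "Sigma_N N"
  let ?n = "real (card ?S)"
  let ?H = "hamiltonian N P"
  define Z where "Z J = (\<Sum>\<sigma>\<in>?S. exp (?H J \<sigma>)) / ?n" for J
  let ?g = "\<lambda>\<tau> is. a is + spin_product \<tau> is * b is"
  have n: "?n > 0"
    using finite_Sigma_N Sigma_N_nonempty by (simp add: card_gt_0_iff)
  have Zpos: "Z J > 0" for J
    unfolding Z_def using n by (intro divide_pos_pos sum_pos finite_Sigma_N Sigma_N_nonempty) auto
  have LP: "log_partition N P 1 J = ln (Z J)" for J
    by (simp add: log_partition_eq_sum Z_def)
  have "(\<Sum>\<tau>\<in>?S. Z (?g \<tau>))
      = (\<Sum>\<tau>\<in>?S. \<Sum>\<sigma>\<in>?S. exp (?H a \<sigma>) * exp (?H b (\<lambda>i\<in>{1..N}. \<tau> i * \<sigma> i))) / ?n"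
    by (simp add: Z_def sum_divide_distrib hamiltonian_add hamiltonian_gauge exp_add)
  also have "\<dots> = (\<Sum>\<sigma>\<in>?S. exp (?H a \<sigma>) * (\<Sum>\<tau>\<in>?S. exp (?H b (\<lambda>i\<in>{1..N}. \<tau> i * \<sigma> i)))) / ?n"
    by (subst sum.swap) (simp add: sum_distrib_left)
  also have "\<dots> = (\<Sum>\<sigma>\<in>?S. exp (?H a \<sigma>) * (\<Sum>\<tau>\<in>?S. exp (?H b \<tau>))) / ?n"
    by (intro arg_cong2[of _ _ _ _ "(/)"] sum.cong refl arg_cong2[of _ _ _ _ "(*)"]
        sum_Sigma_N_translate)
  also have "\<dots> = ?n * (Z a * Z b)"
    using n by (simp add: Z_def sum_distrib_right[symmetric])
  finally have avg: "(\<Sum>\<tau>\<in>?S. Z (?g \<tau>)) = ?n * (Z a * Z b)" .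
  have "(\<Sum>\<tau>\<in>?S. (1 / ?n) * ln (Z (?g \<tau>))) \<le> ln (\<Sum>\<tau>\<in>?S. (1 / ?n) *\<^sub>R Z (?g \<tau>))"
    using n by (intro concave_on_sum[OF finite_Sigma_N Sigma_N_nonempty ln_concave])
      (auto simp: Zpos)
  also have "(\<Sum>\<tau>\<in>?S. (1 / ?n) *\<^sub>R Z (?g \<tau>)) = Z a * Z b"
    using avg n by (simp add: sum_divide_distrib[symmetric])
  also have "ln (Z a * Z b) = ln (Z a) + ln (Z b)"
    using Zpos[of a] Zpos[of b] by (simp add: ln_mult_pos)
  finally show ?thesis
    using n by (simp add: LP sum_divide_distrib[symmetric] field_simps)
qed

lemma free_energy_add_le:
  assumes c: "\<And>is. is \<in> multi_indices N P \<Longrightarrow> c is \<ge> 0"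
    and c': "\<And>is. is \<in> multi_indices N P \<Longrightarrow> c' is \<ge> 0"
  shows "free_energy N P (\<lambda>is. c is + c' is) \<le> free_energy N P c + free_energy N P c'"
proof -
  let ?S = "Sigma_N N"
  let ?n = "real (card ?S)"
  let ?Q = "coupling_law N P c \<Otimes>\<^sub>M coupling_law N P c'"
  let ?L = "log_partition N P 1"
  let ?X = "\<lambda>\<tau> z. ?L (\<lambda>is. fst z is + spin_product \<tau> is * snd z is)"
  have n: "?n > 0"
    using finite_Sigma_N Sigma_N_nonempty by (simp add: card_gt_0_iff)
  have X: "integrable ?Q (?X \<tau>)"
      "(\<integral>z. ?X \<tau> z \<partial>?Q) = free_energy N P (\<lambda>is. c is + c' is)" if t: "\<tau> \<in> ?S" for \<tau>
  proof -
    have "c is + c' is = 1\<^sup>2 * c is + (spin_product \<tau> is)\<^sup>2 * c' is"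
      if "is \<in> multi_indices N P" for "is"
      by (simp add: spin_product_square[OF t that])
    note * = expectation_coupling_law_linear[of N P c c' "\<lambda>is. c is + c' is" "\<lambda>_. 1", OF c c' this,
        where \<beta>=1]
    show "integrable ?Q (?X \<tau>)"
      using *(1) by simp
    show "(\<integral>z. ?X \<tau> z \<partial>?Q) = free_energy N P (\<lambda>is. c is + c' is)"
      using *(2) by (simp add: free_energy_def)
  qed
  have A: "integrable ?Q (\<lambda>z. ?L (fst z))" "(\<integral>z. ?L (fst z) \<partial>?Q) = free_energy N P c"
    using expectation_coupling_law_linear[of N P c c' c "\<lambda>_. 1" "\<lambda>_. 0" 1, OF c c']
    by (simp_all add: free_energy_def)
  have B: "integrable ?Q (\<lambda>z. ?L (snd z))" "(\<integral>z. ?L (snd z) \<partial>?Q) = free_energy N P c'"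
    using expectation_coupling_law_linear[of N P c c' c' "\<lambda>_. 0" "\<lambda>_. 1" 1, OF c c']
    by (simp_all add: free_energy_def)
  have "?n * free_energy N P (\<lambda>is. c is + c' is) = (\<integral>z. (\<Sum>\<tau>\<in>?S. ?X \<tau> z) \<partial>?Q)"
    by (simp add: Bochner_Integration.integral_sum X)
  also have "\<dots> \<le> (\<integral>z. ?n * (?L (fst z) + ?L (snd z)) \<partial>?Q)"
    by (intro integral_mono gauge_averaged_log_partition_le Bochner_Integration.integrable_sum
        integrable_mult_right Bochner_Integration.integrable_add X A B)
  also have "\<dots> = ?n * (free_energy N P c + free_energy N P c')"
    by (simp add: A B)
  finally show ?thesis
    using n by simp
qed

text \<open>
  Both sides are expectations of the same function of one coupling family with variances
  \<open>c\<close>, with the factor \<open>\<beta>\<close> in front of the Hamiltonian or inside the couplings. The second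
  family in the pair has coefficient 0.
\<close>

lemma free_energy_at_eq_scaled_variance:
  assumes c: "\<And>is. is \<in> multi_indices N P \<Longrightarrow> c is \<ge> 0"
  shows "free_energy_at N P \<beta> c = free_energy N P (\<lambda>is. \<beta>\<^sup>2 * c is)"
  using expectation_coupling_law_linear(2)[of N P c c "\<lambda>is. \<beta>\<^sup>2 * c is" "\<lambda>_. \<beta>" "\<lambda>_. 0" 1, OF c c]
    expectation_coupling_law_linear(2)[of N P c c c "\<lambda>_. 1" "\<lambda>_. 0" \<beta>, OF c c]
  by (simp add: free_energy_def log_partition_scale)

theorem corollary2p1:
  fixes N P :: nat and c c' :: "nat list \<Rightarrow> real"
  assumes "N \<ge> 1" and "P \<ge> 1"
    and "\<And>is. is \<in> multi_indices N P \<Longrightarrow> c is \<ge> 0"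
    and "\<And>is. is \<in> multi_indices N P \<Longrightarrow> c' is \<ge> 0"
  shows "free_energy N P (\<lambda>is. c is + c' is) \<le> free_energy N P c + free_energy N P c'
    \<and> (\<forall>\<beta>\<^sub>1\<ge>0. \<forall>\<beta>\<^sub>2\<ge>0. free_energy_at N P (sqrt (\<beta>\<^sub>1\<^sup>2 + \<beta>\<^sub>2\<^sup>2)) c
          \<le> free_energy_at N P \<beta>\<^sub>1 c + free_energy_at N P \<beta>\<^sub>2 c)"
proof (intro conjI allI impI)
  show "free_energy N P (\<lambda>is. c is + c' is) \<le> free_energy N P c + free_energy N P c'"
    using assms(3,4) by (rule free_energy_add_le)
next
  fix \<beta>\<^sub>1 \<beta>\<^sub>2 :: real
  have "free_energy N P (\<lambda>is. \<beta>\<^sub>1\<^sup>2 * c is + \<beta>\<^sub>2\<^sup>2 * c is)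
      \<le> free_energy N P (\<lambda>is. \<beta>\<^sub>1\<^sup>2 * c is) + free_energy N P (\<lambda>is. \<beta>\<^sub>2\<^sup>2 * c is)"
    using assms(3) by (intro free_energy_add_le) auto
  then show "free_energy_at N P (sqrt (\<beta>\<^sub>1\<^sup>2 + \<beta>\<^sub>2\<^sup>2)) c
      \<le> free_energy_at N P \<beta>\<^sub>1 c + free_energy_at N P \<beta>\<^sub>2 c"
    by (simp add: free_energy_at_eq_scaled_variance[OF assms(3)] distrib_right)
qed

end
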